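(* Consider the Directed Multimedia Content Distribution problem ($\mathrm{DMCD}$) on a directed line network with origin node $0$, and let $\mathrm{Square}$ be the algorithm described in the context. There is an absolute constant $c$ such that for every request sequence $r_1,\dots,r_N$ (with nondecreasing times), the edge set $F_{SQ}$ output by $\mathrm{Square}$ is a feasible solution and $|F_{SQ}|\le c\cdot \mathrm{OPT}$, where $\mathrm{OPT}$ is the minimum cost of a feasible solution for these requests. That is, $\mathrm{Square}$ is $O(1)$-competitive for $\mathrm{DMCD}$ in the pseudo online model.
   Context: Time-line graph: the directed line network has nodes $0,1,\dots,n$ and edges $(u,u+1)$. Its time-line graph has a replica $(v,t)$ for every node $v$ and every $t\in\{0,1,2,\dots\}$, horizontal edges $((u,t),(u+1,t))$ and arcs $((v,t),(v,t+1))$. DMCD: given requests (replicas) $r_1=(v_1,t_1),\dots,r_N=(v_N,t_N)$ with $0\le t_1\le\dots\le t_N$, a feasible solution is a set $F$ of edges of the time-line graph such that every request is reachable from the origin $(0,0)$ by a directed path in $F$; its cost is $|F|$. For replicas define $d_\infty((u,s),(v,t))=\max\{t-s,v-u\}$ if $s\le t$ and $u\le v$, and $d_\infty=\infty$ otherwise. Pseudo online model: requests are processed in order, edges once added are never removed, but (unlike a fully online algorithm) edges at times earlier than the current request may be added. Algorithm $\mathrm{Square}$: start with $F=\{(0,0)\}$ and $t_0=0$. For $i=1,\dots,N$: (SQ1) add the arcs from $(0,t_{i-1})$ to $(0,t_i)$; (SQ2) let $\rho(i)=\min\{d_\infty(q,r_i): q \text{ a replica of } F\}$; (SQ3) among replicas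 of $F$ lying in the rectangle $[v_i-5\rho(i),v_i]\times[t_i-5\rho(i),t_i]$ choose a replica $q_i=(u_i,s_i)$ whose node $u_i$ is leftmost (minimal), ties broken arbitrarily; (SQ4) add the arcs from $(u_i,s_i)$ to $(u_i,t_i)$ and the horizontal edges from $(u_i,t_i)$ to $(v_i,t_i)$; (SQ5) add the arcs from $(u_i,t_i)$ to $(u_i,t_i+4\rho(i))$. The output is the final edge set $F_{SQ}$. *)

theory Defs
  imports Complex_Main "HOL-Library.Extended_Nat"
begin

text \<open>A replica \<open>(v, t)\<close> is the copy of node \<open>v\<close> at time \<open>t\<close>; an edge is an ordered pair of
  replicas, so a set of edges is a relation on replicas and reachability by a directed path
  in \<open>F\<close> is membership in \<open>F\<^sup>*\<close>.\<close>

type_synonym replica = "nat \<times> nat"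
type_synonym edge = "replica \<times> replica"

definition horizontal :: "nat \<Rightarrow> nat \<Rightarrow> nat \<Rightarrow> edge set" where
  "horizontal u v t = {((x, t), (Suc x, t)) | x. u \<le> x \<and> x < v}"

definition arcs :: "nat \<Rightarrow> nat \<Rightarrow> nat \<Rightarrow> edge set" where
  "arcs v s t = {((v, k), (v, Suc k)) | k. s \<le> k \<and> k < t}"

definition timeline_edges :: "nat \<Rightarrow> edge set" where
  "timeline_edges n =
     {((u, t), (Suc u, t)) | u t. u < n} \<union> {((v, t), (v, Suc t)) | v t. v \<le> n}"

definition request_sequence :: "nat \<Rightarrow> replica list \<Rightarrow> bool" where
  "request_sequence n rs \<longleftrightarrow> (\<forall>(v, t) \<in> set rs. v \<le> n) \<and> sorted (map snd rs)"

text \<open>Finiteness is required because \<open>card\<close> is \<open>0\<close> on infinite sets; an infinite edge set has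
  infinite cost and is irrelevant for the optimum.\<close>

definition dmcd_feasible :: "nat \<Rightarrow> replica list \<Rightarrow> edge set \<Rightarrow> bool" where
  "dmcd_feasible n rs F \<longleftrightarrow>
     finite F \<and> F \<subseteq> timeline_edges n \<and> (\<forall>r \<in> set rs. ((0, 0), r) \<in> F\<^sup>*)"

definition dmcd_opt :: "nat \<Rightarrow> replica list \<Rightarrow> nat" where
  "dmcd_opt n rs = (LEAST k. \<exists>F. dmcd_feasible n rs F \<and> card F = k)"

fun d_infty :: "replica \<Rightarrow> replica \<Rightarrow> enat" where
  "d_infty (u, s) (v, t) = (if s \<le> t \<and> u \<le> v then enat (max (t - s) (v - u)) else \<infinity>)"

text \<open>The algorithm starts from the single replica \<open>(0, 0)\<close> without edges, so this replica always
  belongs to the current solution.\<close>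

definition replicas :: "edge set \<Rightarrow> replica set" where
  "replicas F = insert (0, 0) (Field F)"

text \<open>The rectangle \<open>[v - l, v] \<times> [t - l, t]\<close>, written without truncated subtraction.\<close>

definition rectangle :: "replica \<Rightarrow> nat \<Rightarrow> replica set" where
  "rectangle r l =
     {(u, s). u \<le> fst r \<and> fst r \<le> u + l \<and> s \<le> snd r \<and> snd r \<le> s + l}"

text \<open>One iteration: \<open>t0\<close> is the time of the previous request and \<open>F\<close>, \<open>F'\<close> are the edge sets before
  and after serving \<open>(v, t)\<close>. It is a relation because ties in the choice of the leftmost
  replica \<open>(u, s)\<close> are broken arbitrarily.\<close>

inductive square_step :: "nat \<Rightarrow> edge set \<Rightarrow> replica \<Rightarrow> edge set \<Rightarrow> bool" where
  "F1 = F \<union> arcs 0 t0 t \<Longrightarrow>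
   enat \<rho> = (INF q \<in> replicas F1. d_infty q (v, t)) \<Longrightarrow>
   (u, s) \<in> replicas F1 \<inter> rectangle (v, t) (5 * \<rho>) \<Longrightarrow>
   (\<forall>(u', s') \<in> replicas F1 \<inter> rectangle (v, t) (5 * \<rho>). u \<le> u') \<Longrightarrow>
   F' = F1 \<union> arcs u s t \<union> horizontal u v t \<union> arcs u t (t + 4 * \<rho>) \<Longrightarrow>
   square_step t0 F (v, t) F'"

inductive square_from :: "nat \<Rightarrow> edge set \<Rightarrow> replica list \<Rightarrow> edge set \<Rightarrow> bool" where
  "square_from t0 F [] F"
| "square_step t0 F (v, t) F' \<Longrightarrow> square_from t F' rs F'' \<Longrightarrow> square_from t0 F ((v, t) # rs) F''"

definition square_output :: "replica list \<Rightarrow> edge set \<Rightarrow> bool" where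
  "square_output rs F \<longleftrightarrow> square_from 0 {} rs F"

text \<open>The two notions above are not vacuous: every request sequence has a feasible solution, and
  on every request sequence the algorithm can be run to completion.\<close>

lemma arcs_path: "s \<le> t \<Longrightarrow> ((v, s), (v, t)) \<in> (arcs v s t)\<^sup>*"
proof (induction t rule: dec_induct)
  case (step k)
  have "(arcs v s k)\<^sup>* \<subseteq> (arcs v s (Suc k))\<^sup>*"
    by (rule rtrancl_mono) (auto simp: arcs_def)
  moreover have "((v, k), (v, Suc k)) \<in> arcs v s (Suc k)"
    using step by (auto simp: arcs_def)
  ultimately show ?case using step by (meson rtrancl.rtrancl_into_rtrancl subsetD)
qed simp

lemma horizontal_path: "u \<le> v \<Longrightarrow> ((u, t), (v, t)) \<in> (horizontal u v t)\<^sup>*"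
proof (induction v rule: dec_induct)
  case (step k)
  have "(horizontal u k t)\<^sup>* \<subseteq> (horizontal u (Suc k) t)\<^sup>*"
    by (rule rtrancl_mono) (auto simp: horizontal_def)
  moreover have "((k, t), (Suc k, t)) \<in> horizontal u (Suc k) t"
    using step by (auto simp: horizontal_def)
  ultimately show ?case using step by (meson rtrancl.rtrancl_into_rtrancl subsetD)
qed simp

lemma dmcd_feasible_exists:
  assumes "request_sequence n rs"
  shows "\<exists>F. dmcd_feasible n rs F"
proof -
  define F where "F = (\<Union>(v, t) \<in> set rs. arcs 0 0 t \<union> horizontal 0 v t)"
  have "arcs 0 0 t = (\<lambda>k. ((0, k), (0, Suc k))) ` {..<t}" for t
    by (auto simp: arcs_def)
  moreover have "horizontal 0 v t = (\<lambda>x. ((x, t), (Suc x, t))) ` {..<v}" for v t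
    by (auto simp: horizontal_def)
  ultimately have "finite F" by (auto simp: F_def)
  moreover have "F \<subseteq> timeline_edges n"
    using assms
    by (fastforce simp: F_def timeline_edges_def request_sequence_def arcs_def horizontal_def)
  moreover have "((0, 0), r) \<in> F\<^sup>*" if "r \<in> set rs" for r
  proof -
    obtain v t where r: "r = (v, t)" by (cases r)
    have "arcs 0 0 t \<subseteq> F" "horizontal 0 v t \<subseteq> F" using that r by (auto simp: F_def)
    then have "((0, 0), (0, t)) \<in> F\<^sup>*" "((0, t), (v, t)) \<in> F\<^sup>*"
      using arcs_path[of 0 t 0] horizontal_path[of 0 v t] by (auto dest: rtrancl_mono)
    then show ?thesis using r by (simp add: rtrancl_trans)
  qed
  ultimately show ?thesis by (auto simp: dmcd_feasible_def)
qed

lemma arcs_extend_replicas: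
  assumes "(v, s) \<in> replicas F" "s \<le> t"
  shows "(v, t) \<in> replicas (F \<union> arcs v s t)"
proof (cases "s = t")
  case True
  then show ?thesis using assms by (auto simp: replicas_def Field_def)
next
  case False
  then have "((v, t - 1), (v, t)) \<in> arcs v s t" using assms(2) by (auto simp: arcs_def)
  then have "(v, t) \<in> Field (F \<union> arcs v s t)" by (auto simp: Field_def)
  then show ?thesis by (simp add: replicas_def)
qed

lemma square_step_exists:
  assumes "(0, t0) \<in> replicas F" "t0 \<le> t"
  shows "\<exists>F'. square_step t0 F (v, t) F' \<and> (0, t) \<in> replicas F'"
proof -
  define F1 where "F1 = F \<union> arcs 0 t0 t"
  have 0: "(0, t) \<in> replicas F1" using arcs_extend_replicas[OF assms] by (simp add: F1_def)
  let ?D = "(\<lambda>q. d_infty q (v, t)) ` replicas F1"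
  have "Inf ?D \<in> ?D" using imageI[OF 0] by (rule wellorder_InfI)
  then obtain q where q: "q \<in> replicas F1" "d_infty q (v, t) = Inf ?D" by auto
  have "Inf ?D \<le> d_infty (0, t) (v, t)" using 0 by (intro INF_lower)
  then have "Inf ?D \<le> enat v" by simp
  then obtain \<rho> where \<rho>: "enat \<rho> = Inf ?D" by (cases "Inf ?D") auto
  let ?R = "replicas F1 \<inter> rectangle (v, t) (5 * \<rho>)"
  have "d_infty q (v, t) = enat \<rho>" using q \<rho> by simp
  then have "q \<in> ?R" using q(1) by (cases q) (auto simp: rectangle_def split: if_splits)
  then obtain p where p: "p \<in> ?R" "\<And>p'. p' \<in> ?R \<Longrightarrow> fst p \<le> fst p'"
    using ex_has_least_nat[of "\<lambda>p. p \<in> ?R" q fst] by blast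
  obtain u s where us: "p = (u, s)" by (cases p)
  let ?F' = "F1 \<union> arcs u s t \<union> horizontal u v t \<union> arcs u t (t + 4 * \<rho>)"
  have "square_step t0 F (v, t) ?F'"
    using F1_def \<rho> p us by (intro square_step.intros[of F1 _ _ _ \<rho> _ u s]) fastforce+
  moreover have "(0, t) \<in> replicas ?F'" using 0 by (auto simp: replicas_def Field_def)
  ultimately show ?thesis by blast
qed

lemma square_output_exists:
  assumes "request_sequence n rs"
  shows "\<exists>F. square_output rs F"
proof -
  have "\<exists>F'. square_from t0 F rs F'"
    if "(0, t0) \<in> replicas F" "sorted (t0 # map snd rs)" for t0 F
    using that
  proof (induction rs arbitrary: t0 F)
    case Nil
    then show ?case by (auto intro: square_from.intros)
  next
    case (Cons r rs)
    obtain v t where r: "r = (v, t)" by (cases r)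
    obtain F' where F': "square_step t0 F (v, t) F'" "(0, t) \<in> replicas F'"
      using square_step_exists[of t0 F t v] Cons.prems r by auto
    then obtain F'' where "square_from t F' rs F''"
      using Cons.IH[of t F'] Cons.prems r by auto
    then show ?case using F' r by (auto intro: square_from.intros)
  qed
  from this[of 0 "{}"] show ?thesis
    using assms by (simp add: square_output_def replicas_def request_sequence_def)
qed

end

theory Submission
  imports Defs
begin

text \<open>The cost of \<open>Square\<close> is at most \<open>t\<^sub>N + 14 \<cdot> \<Sum>i. \<rho> i\<close>, so the radii must be bounded by the optimum. Any
  solution spends at least \<open>\<rho> i\<close> edges inside the square of side \<open>\<rho> i\<close> with upper right corner \<open>r\<^sub>i\<close>,
  which suffices for the requests whose square is disjoint from all later squares. If some later
  square meets the one of \<open>r\<^sub>i\<close>, then \<open>v i - u i < \<rho> i\<close>, hence at that time the solution has no replica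
  in a wide region to the left of column \<open>u i\<close>, and the first later request \<open>r\<^sub>j\<close> hitting the square
  lies in those columns.

  If \<open>t j \<le> t i + 4 \<cdot> \<rho> i\<close>, each of at least \<open>4 \<cdot> \<rho> i\<close> columns \<open>x\<close> of the region is charged to the request
  that first enters it, whose square spans \<open>x\<close>. If \<open>t j > t i + 4 \<cdot> \<rho> i\<close>, each of the \<open>4 \<cdot> \<rho> i\<close> times
  following \<open>t i\<close> is charged to \<open>r\<^sub>j\<close>, whose square spans these times. The arcs added in (SQ5) keep
  another such request out of the way for \<open>4 \<cdot> \<rho> i\<close> time units, so both chargings are injective. The
  hit requests thus carry at most half of the sum of all radii.\<close>

section \<open>Runs of \<open>Square\<close> as sequences of columns, times and radii\<close>

locale square_data =
  fixes v t u s \<rho> :: "nat \<Rightarrow> nat"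
begin

definition served :: "nat \<Rightarrow> replica set" where
  "served k = {(u k, y) | y. s k \<le> y \<and> y \<le> t k + 4 * \<rho> k} \<union> {(x, t k) | x. u k \<le> x \<and> x \<le> v k}"

text \<open>The state after (SQ1) of round \<open>i\<close>, in which the radius is measured and the
  source chosen; hence the origin column already extends to \<open>t i\<close>.\<close>

definition known :: "nat \<Rightarrow> replica set" where
  "known i = {(0, y) | y. y \<le> t i} \<union> (\<Union>k<i. served k)"

text \<open>Strict on the far sides, so every replica inside is at distance below
  \<open>\<rho> i\<close> from the request.\<close>

definition square :: "nat \<Rightarrow> replica set" where
  "square i = {(x, y). x \<le> v i \<and> v i < x + \<rho> i \<and> y \<le> t i \<and> t i < y + \<rho> i}"

end

text \<open>\<open>rho_le\<close> and \<open>rho_attained\<close> express (SQ2), the assumptions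
  from \<open>source_known\<close> to \<open>leftmost\<close> express (SQ3). Only the column of the
  source is required to be minimal, so every tie-breaking rule is covered.\<close>

locale square_run = square_data v t u s \<rho> for v t u s \<rho> :: "nat \<Rightarrow> nat" +
  fixes N :: nat
  assumes t_mono: "i \<le> j \<Longrightarrow> j < N \<Longrightarrow> t i \<le> t j"
    and rho_le: "i < N \<Longrightarrow> (x, y) \<in> known i \<Longrightarrow> x \<le> v i \<Longrightarrow> y \<le> t i \<Longrightarrow> \<rho> i \<le> max (t i - y) (v i - x)"
    and rho_attained: "i < N \<Longrightarrow> \<exists>x y. (x, y) \<in> known i \<and> x \<le> v i \<and> y \<le> t i \<and> max (t i - y) (v i - x) = \<rho> i"
    and source_known: "i < N \<Longrightarrow> (u i, s i) \<in> known i"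
    and u_le: "i < N \<Longrightarrow> u i \<le> v i" and v_le: "i < N \<Longrightarrow> v i \<le> u i + 5 * \<rho> i"
    and s_le: "i < N \<Longrightarrow> s i \<le> t i" and t_le: "i < N \<Longrightarrow> t i \<le> s i + 5 * \<rho> i"
    and leftmost: "i < N \<Longrightarrow> (x, y) \<in> known i \<Longrightarrow> x \<le> v i \<Longrightarrow> v i \<le> x + 5 * \<rho> i \<Longrightarrow>
      y \<le> t i \<Longrightarrow> t i \<le> y + 5 * \<rho> i \<Longrightarrow> u i \<le> x"
begin

text \<open>For \<open>i\<close> and a later \<open>j\<close> this is equivalent to the two squares meeting: if \<open>u i \<le> v j\<close>, the
  horizontal edges added for \<open>i\<close> would come too close to \<open>r\<^sub>j\<close>.\<close>

definition hits :: "nat \<Rightarrow> nat \<Rightarrow> bool" where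
  "hits i j \<longleftrightarrow> i < j \<and> j < N \<and> v i < v j + \<rho> i \<and> v j < u i \<and> t j < t i + \<rho> j"

definition bad :: "nat set" where
  "bad = {i. \<exists>j. hits i j}"

definition blocker :: "nat \<Rightarrow> nat" where
  "blocker i = (LEAST j. hits i j)"

text \<open>The condition \<open>u k \<le> v (blocker i)\<close> discards requests served entirely
  to the right of the blocker. For bad \<open>i\<close> the blocker itself qualifies for each
  \<open>x\<close> up to its own column, so the minimum exists.\<close>

definition invader :: "nat \<Rightarrow> nat \<Rightarrow> nat" where
  "invader i x = (LEAST k. i < k \<and> u k \<le> v (blocker i) \<and> x \<le> v k)"

section \<open>Consequences of the choice of radius and source\<close>

lemma horizontal_known: "k < i \<Longrightarrow> u k \<le> x \<Longrightarrow> x \<le> v k \<Longrightarrow> (x, t k) \<in> known i"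
  by (auto simp: known_def served_def)

lemma vertical_known: "k < i \<Longrightarrow> s k \<le> y \<Longrightarrow> y \<le> t k + 4 * \<rho> k \<Longrightarrow> (u k, y) \<in> known i"
  by (auto simp: known_def served_def)

lemma served_column:
  assumes "(x, y) \<in> served k" "k < N"
  shows "u k \<le> x" "x \<le> v k"
  using assms u_le[of k] by (auto simp: served_def)

lemma known_cases:
  assumes "(x, y) \<in> known m" "0 < x"
  obtains "(x, y) \<in> known i" | k where "i \<le> k" "k < m" "(x, y) \<in> served k"
  using assms by (fastforce simp: known_def not_less[symmetric])

text \<open>Extends \<open>leftmost\<close> to replicas later than \<open>t i\<close>: these lie on
  arcs of (SQ5), whose column was already present at time \<open>t i\<close>.\<close>

lemma known_column:
  assumes "i < N" "(x, y) \<in> known i" "x \<le> v i" "v i \<le> x + 5 * \<rho> i" "t i \<le> y + 5 * \<rho> i"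
  shows "u i \<le> x"
proof (cases "y \<le> t i")
  case True
  then show ?thesis using leftmost assms by blast
next
  case False
  then obtain k where k: "k < i" "(x, y) \<in> served k"
    using assms by (auto simp: known_def)
  have tk: "t k \<le> t i" using t_mono k assms by simp
  then have x: "x = u k" "y \<le> t k + 4 * \<rho> k"
    using k False by (auto simp: served_def)
  have "(u k, t i) \<in> known i"
    using vertical_known[of k i "t i"] k s_le[of k] assms tk x False by auto
  then show ?thesis using leftmost[of i x "t i"] assms x by auto
qed

text \<open>Requests with \<open>v i < u i + \<rho> i\<close> are called uncovered. The origin
  column is known at time \<open>t i\<close> and at distance at least \<open>\<rho> i\<close>; had
  it been in range, it would have been chosen.\<close>

lemma uncovered_far:
  assumes "i < N" "v i < u i + \<rho> i"
  shows "5 * \<rho> i < v i"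
proof (rule ccontr)
  assume "\<not> ?thesis"
  moreover have k: "(0, t i) \<in> known i" by (auto simp: known_def)
  ultimately have "u i \<le> 0" using leftmost[of i 0 "t i"] assms by auto
  then show False using rho_le[of i 0 "t i"] k assms by auto
qed

text \<open>In range, the column would force \<open>u i \<le> x\<close>, and \<open>(x, t i)\<close>
  would then be closer than the radius.\<close>

lemma uncovered_not_reached:
  assumes "i < N" "v i < u i + \<rho> i" "(x, t i) \<in> known i" "x \<le> v i"
  shows "x + 5 * \<rho> i < v i"
proof (rule ccontr)
  assume "\<not> ?thesis"
  then have "u i \<le> x" using leftmost[of i x "t i"] assms by auto
  then show False using rho_le[of i x "t i"] assms by auto
qed

text \<open>Row \<open>t k\<close> is less than \<open>\<rho> j\<close> below \<open>t j\<close>, so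
  the radius can only be respected if the horizontal edges of \<open>k\<close> stop
  \<open>\<rho> j\<close> columns short of \<open>v j\<close>.\<close>

lemma hits_bypass:
  assumes "hits i j" "i \<le> k" "k < j" "u k \<le> v j"
  shows "v k + \<rho> j \<le> v j"
proof -
  have j: "j < N" and tj: "t j < t i + \<rho> j" using assms by (auto simp: hits_def)
  have "t i \<le> t k" "t k \<le> t j" using t_mono assms j by auto
  moreover have "(min (v k) (v j), t k) \<in> known j"
    using horizontal_known u_le[of k] assms j by auto
  ultimately have "\<rho> j \<le> v j - min (v k) (v j)" "0 < \<rho> j"
    using rho_le[OF j, of "min (v k) (v j)" "t k"] tj by auto
  then show ?thesis by auto
qed

lemma bad_blocker: "i \<in> bad \<Longrightarrow> hits i (blocker i)"
  unfolding bad_def blocker_def by (auto intro: LeastI)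

lemma before_blocker: "k < blocker i \<Longrightarrow> \<not> hits i k"
  unfolding blocker_def by (rule not_less_Least)

lemma hits_uncovered:
  assumes "hits i j"
  shows "i < N" "v i < u i + \<rho> i"
  using assms by (auto simp: hits_def)

lemma bad_subset: "bad \<subseteq> {..<N}"
  using hits_uncovered by (auto simp: bad_def)

lemma good_squares_disjoint:
  assumes "i < j" "j < N" "i \<notin> bad"
  shows "square i \<inter> square j = {}"
proof (rule ccontr)
  assume "\<not> ?thesis"
  then obtain x y where x: "x \<le> v i" "v i < x + \<rho> i" "x \<le> v j" "v j < x + \<rho> j"
    and y: "y \<le> t i" "t j < y + \<rho> j"
    by (auto simp: square_def)
  have tij: "t i \<le> t j" using t_mono assms by simp
  show False
  proof (cases "v j < u i")
    case True
    then have "hits i j" using assms x y by (auto simp: hits_def)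
    then show False using assms by (auto simp: bad_def)
  next
    case False
    then have "(min (v i) (v j), t i) \<in> known j"
      using horizontal_known[OF assms(1)] u_le[of i] assms by auto
    then show False
      using rho_le[of j "min (v i) (v j)" "t i"] assms x y tij by auto
  qed
qed

text \<open>Descent: each replica in the strip between columns \<open>v j\<close> and \<open>v i'\<close> was added after request
  \<open>i\<close>, by a request whose own source is an earlier replica of the same strip.\<close>

lemma strip_empty:
  assumes ij: "hits i j" and i': "i < i'" "i' < j"
    and unc: "v i' < u i' + \<rho> i'"
    and v: "v j < v i'" "v i' \<le> v j + 5 * \<rho> i'" "v i' < u i"
    and ti': "t i' \<le> t i + 4 * \<rho> i"
    and x: "v j < x" "x \<le> v i'" and y: "t i \<le> y + 5 * \<rho> i"
    and m: "m \<le> i'"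
  shows "(x, y) \<notin> known m"
  using x y m
proof (induction m arbitrary: x y rule: less_induct)
  case (less m)
  have N: "i < N" "i' < N" "j < N" using ij i' by (auto simp: hits_def)
  show ?case
  proof
    assume "(x, y) \<in> known m"
    then consider "(x, y) \<in> known i" | k where "i \<le> k" "k < m" "(x, y) \<in> served k"
      using known_cases[of x y m i] less.prems by auto
    then show False
    proof cases
      case 1
      have "x < u i" "v i \<le> x + 5 * \<rho> i" "x \<le> v i"
        using less.prems v ij u_le[OF N(1)] by (auto simp: hits_def)
      then show False using known_column[OF N(1) 1] less.prems by auto
    next
      case (2 k)
      have kN: "k < N" using 2 less.prems N by auto
      have ux: "u k \<le> x" "x \<le> v k" using served_column[OF 2(3) kN] by auto
      have "i \<noteq> k" using ux less.prems v by auto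
      have uk: "v j < u k"
        using hits_bypass[OF ij, of k] 2 less.prems i' ux by fastforce
      have tk: "t i \<le> t k" "t k \<le> t i'" using t_mono 2 kN less.prems N by auto
      \<comment> \<open>Otherwise the arcs of (SQ5) for \<open>k\<close> would bring column
        \<open>u k\<close> to time \<open>t i'\<close>, in range of the uncovered
        \<open>i'\<close>.\<close>
      have "t k + 4 * \<rho> k < t i'"
      proof (rule ccontr)
        assume "\<not> ?thesis"
        then have "(u k, t i') \<in> known i'"
          using vertical_known[of k i' "t i'"] s_le[OF kN] tk 2 less.prems by auto
        then show False
          using uncovered_not_reached[OF N(2) unc] ux less.prems uk v by fastforce
      qed
      \<comment> \<open>Indeed \<open>4 * \<rho> k < t i' - t k \<le> 4 * \<rho> i\<close>. So the
        source of \<open>k\<close>, at most \<open>5 * \<rho> k\<close> earlier, meets the time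
        bound of the induction hypothesis.\<close>
      then have "\<rho> k < \<rho> i" using ti' tk by auto
      then have "t i \<le> s k + 5 * \<rho> i" using t_le[OF kN] tk by auto
      then have "(u k, s k) \<notin> known k"
        using less.IH[of k "u k" "s k"] 2 uk ux less.prems by auto
      then show False using source_known[OF kN] by blast
    qed
  qed
qed

text \<open>Suppose \<open>i'\<close> came while the (SQ5) arcs of \<open>i\<close> last. If
  \<open>u i \<le> v i'\<close>, these arcs are in range of \<open>i'\<close>, which is uncovered.
  Otherwise \<open>i'\<close> fails to hit \<open>i\<close> only by being late, which puts its
  nearest replica into the strip shown empty by \<open>strip_empty\<close>.\<close>

lemma uncovered_late:
  assumes bad: "i \<in> bad" and j: "j = blocker i" and i': "i < i'" "i' < j"
    and unc: "v i' < u i' + \<rho> i'"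
    and v: "v j < v i'" "v i' \<le> v j + 5 * \<rho> i'"
  shows "t i + 4 * \<rho> i < t i'"
proof (rule ccontr)
  assume "\<not> ?thesis"
  then have ti': "t i' \<le> t i + 4 * \<rho> i" by simp
  have ij: "hits i j" using bad bad_blocker j by blast
  have N: "i < N" "i' < N" "j < N" using ij i' by (auto simp: hits_def)
  have tii': "t i \<le> t i'" using t_mono i' N by simp
  have vi: "v i < v j + \<rho> i" "v j < u i" using ij by (auto simp: hits_def)
  have ui': "v j < u i'" using hits_bypass[OF ij, of i'] i' v by fastforce
  show False
  proof (cases "u i \<le> v i'")
    case True
    have "(u i, t i') \<in> known i'"
      using vertical_known[OF i'(1)] s_le[OF N(1)] tii' ti' by auto
    then show False using uncovered_not_reached[OF N(2) unc] True v vi by fastforce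
  next
    case False
    then have late: "t i + \<rho> i' \<le> t i'"
      using before_blocker[of i' i] i' N v vi j by (auto simp: hits_def)
    obtain x y where q: "(x, y) \<in> known i'" "x \<le> v i'" "y \<le> t i'" "max (t i' - y) (v i' - x) = \<rho> i'"
      using rho_attained[OF N(2)] by blast
    then have "u i' \<le> x" using leftmost[OF N(2) q(1)] by auto
    moreover have "t i \<le> y + 5 * \<rho> i" using q late by auto
    ultimately show False
      using strip_empty[OF ij i' unc v _ ti', of x y i'] q False ui' by auto
  qed
qed

text \<open>If \<open>x\<close> were left of the square of the invader \<open>k\<close>, the replica
  nearest to \<open>k\<close> would lie between columns \<open>x\<close> and \<open>v k\<close>. It
  is in range of \<open>i\<close> but left of \<open>u i\<close>, so it was not known to
  \<open>i\<close>; added later, it stems from an earlier request invading column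
  \<open>x\<close>.\<close>

lemma invader:
  assumes "i \<in> bad" "x \<le> v (blocker i)" "v i \<le> x + 5 * \<rho> i"
  shows "i < invader i x" "invader i x \<le> blocker i" "invader i x < N"
    "x \<le> v (invader i x)" "v (invader i x) < x + \<rho> (invader i x)"
proof -
  define j where "j = blocker i"
  define k where "k = invader i x"
  let ?Q = "\<lambda>k. i < k \<and> u k \<le> v j \<and> x \<le> v k"
  have ij: "hits i j" using assms bad_blocker j_def by blast
  then have N: "i < N" "j < N" "i < j" by (auto simp: hits_def)
  have vi: "v i < v j + \<rho> i" "v j < u i" using ij by (auto simp: hits_def)
  have kQ: "k = (LEAST k. ?Q k)" by (simp add: k_def j_def invader_def)
  have Qj: "?Q j" using N u_le[of j] assms by (auto simp: j_def)
  have Qk: "?Q k" unfolding kQ by (rule LeastI[of ?Q j]) (use Qj in simp)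
  have kj: "k \<le> j" unfolding kQ by (rule Least_le[of ?Q j]) (use Qj in simp)
  have kN: "k < N" using kj N by simp
  have vk: "v k \<le> v j" using hits_bypass[OF ij, of k] Qk kj by (cases "k = j") auto
  have "v k < x + \<rho> k"
  proof (rule ccontr)
    assume *: "\<not> ?thesis"
    obtain x' y where q: "(x', y) \<in> known k" "x' \<le> v k" "y \<le> t k" "max (t k - y) (v k - x') = \<rho> k"
      using rho_attained[OF kN] by blast
    have x': "x \<le> x'" using q * by auto
    \<comment> \<open>Columns \<open>x\<close> and \<open>v k\<close> both lie in the range of
      \<open>i\<close>; the small radius keeps \<open>y\<close> in its time range too.\<close>
    have "\<rho> k \<le> 5 * \<rho> i" using * vk vi u_le[OF N(1)] assms(3) by auto
    moreover have "t i \<le> t k" using t_mono Qk kN by simp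
    ultimately have y: "t i \<le> y + 5 * \<rho> i" using q by auto
    have "0 < x'" using x' assms(3) uncovered_far[OF hits_uncovered[OF ij]] by auto
    with q(1) consider "(x', y) \<in> known i" | k' where "i \<le> k'" "k' < k" "(x', y) \<in> served k'"
      using known_cases[of x' y k i] by blast
    then show False
    proof cases
      case 1
      then show False
        using known_column[OF N(1) 1] y x' q vk vi u_le[OF N(1)] assms(3) by auto
    next
      case (2 k')
      have c: "u k' \<le> x'" "x' \<le> v k'" using served_column[OF 2(3)] 2 kN by auto
      then have "i \<noteq> k'" using q vk vi by auto
      then have "?Q k'" using 2 c q vk x' by auto
      then show False using not_less_Least[of k' ?Q] 2 kQ by blast
    qed
  qed
  then show "i < invader i x" "invader i x \<le> blocker i" "invader i x < N"
    "x \<le> v (invader i x)" "v (invader i x) < x + \<rho> (invader i x)"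
    using Qk kj kN by (auto simp: k_def j_def)
qed

section \<open>Charging the radii of hit requests\<close>

lemma before_invader:
  assumes "i < k" "k < invader i x" "x \<le> v k"
  shows "v (blocker i) < u k"
  using not_less_Least[OF assms(2)[unfolded invader_def]] assms by auto

lemma sum_rho_quick:
  "4 * (\<Sum>i | i \<in> bad \<and> t (blocker i) \<le> t i + 4 * \<rho> i. \<rho> i) \<le> (\<Sum>i<N. \<rho> i)"
proof -
  define A where "A = {i \<in> bad. t (blocker i) \<le> t i + 4 * \<rho> i}"
  define B where "B i = {x. x \<le> v (blocker i) \<and> v i \<le> x + 5 * \<rho> i}" for i
  define C where "C k = {x. x \<le> v k \<and> v k < x + \<rho> k}" for k
  let ?f = "\<lambda>(i, x). (invader i x, x)"
  have fA: "finite A" using bad_subset finite_subset by (fastforce simp: A_def)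
  have fB: "finite (B i)" and fC: "finite (C i)" for i
    by (rule finite_subset[of _ "{..v (blocker i)}"] finite_subset[of _ "{..v i}"];
        auto simp: B_def C_def)+
  have B: "4 * \<rho> i \<le> card (B i)" if "i \<in> A" for i
  proof -
    \<comment> \<open>The second inequality keeps \<open>v i - 5 * \<rho> i\<close> from truncating;
      the first makes the interval from there to the blocker's column long enough.\<close>
    have "v i < v (blocker i) + \<rho> i" "5 * \<rho> i < v i"
      using that bad_blocker[of i] uncovered_far[of i] hits_uncovered[of i]
      by (auto simp: A_def hits_def)
    moreover have "B i = {v i - 5 * \<rho> i..v (blocker i)}" by (auto simp: B_def)
    ultimately show ?thesis by auto
  qed
  have C: "card (C k) \<le> \<rho> k" for k
  proof -
    have "C k \<subseteq> {Suc (v k) - \<rho> k..<Suc (v k)}" by (auto simp: C_def)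
    from card_mono[OF _ this] show ?thesis by auto
  qed
  \<comment> \<open>Here \<open>i'\<close> reaches column \<open>x\<close> before the common
    invader, so it starts right of the blocker of \<open>i\<close>. By \<open>uncovered_late\<close>
    it comes after the (SQ5) window of \<open>i\<close>, yet it precedes the blocker, which lies in
    that window.\<close>
  have clash: False
    if "i < i'" "i \<in> A" "i' \<in> A" "x \<in> B i" "x \<in> B i'" "invader i x = invader i' x" for i i' x
  proof -
    have bads: "i \<in> bad" "i' \<in> bad" using that by (auto simp: A_def)
    note k = invader[OF bads(1), of x] and k' = invader[OF bads(2), of x]
    have hit: "hits i (blocker i)" "hits i' (blocker i')" using bads bad_blocker by auto
    have "x \<le> v i'" using hit that u_le[of i'] hits_uncovered[OF hit(2)] by (auto simp: B_def hits_def)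
    moreover have "i' < invader i x" using k' that by (auto simp: B_def)
    ultimately have "v (blocker i) < u i'" using before_invader that by blast
    moreover have i'j: "i' < blocker i" using k k' that by (auto simp: B_def)
    ultimately have "t i + 4 * \<rho> i < t i'"
      using uncovered_late[OF bads(1) refl that(1)] hits_uncovered[OF hit(2)] u_le[of i'] that
      by (auto simp: B_def)
    moreover have "t i' \<le> t (blocker i)" using t_mono i'j hit by (auto simp: hits_def)
    ultimately show False using that by (auto simp: A_def)
  qed
  have "inj_on ?f (Sigma A B)"
  proof (rule inj_onI, clarsimp)
    fix i i' x assume "i \<in> A" "i' \<in> A" "x \<in> B i" "x \<in> B i'" "invader i x = invader i' x"
    then show "i = i'" using clash[of i i' x] clash[of i' i x] by (cases i i' rule: linorder_cases) auto
  qed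
  moreover have "?f ` Sigma A B \<subseteq> Sigma {..<N} C"
    using invader by (auto simp: A_def B_def C_def)
  ultimately have le: "card (Sigma A B) \<le> card (Sigma {..<N} C)"
    using fC by (intro card_inj_on_le[of ?f]) auto
  have "4 * (\<Sum>i\<in>A. \<rho> i) \<le> (\<Sum>i\<in>A. card (B i))"
    using B by (auto simp: sum_distrib_left intro: sum_mono)
  also have "\<dots> \<le> (\<Sum>k<N. card (C k))" using le fA fB fC by (simp add: card_SigmaI)
  also have "\<dots> \<le> (\<Sum>k<N. \<rho> k)" using C by (intro sum_mono)
  finally show ?thesis by (simp add: A_def)
qed

text \<open>The same count with times: \<open>t j < t i + \<rho> j\<close> and the lateness of the
  blocker \<open>j\<close> put all \<open>4 * \<rho> i\<close> times after \<open>t i\<close> into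
  the rows of its square. For requests sharing a blocker, \<open>uncovered_late\<close> separates
  the windows.\<close>

lemma sum_rho_slow:
  "4 * (\<Sum>i | i \<in> bad \<and> t i + 4 * \<rho> i < t (blocker i). \<rho> i) \<le> (\<Sum>i<N. \<rho> i)"
proof -
  define A where "A = {i \<in> bad. t i + 4 * \<rho> i < t (blocker i)}"
  define B where "B i = {t i<..t i + 4 * \<rho> i}" for i
  define C where "C k = {y. y \<le> t k \<and> t k < y + \<rho> k}" for k
  let ?f = "\<lambda>(i, y). (blocker i, y)"
  have fA: "finite A" using bad_subset finite_subset by (fastforce simp: A_def)
  have fC: "finite (C k)" for k
    by (rule finite_subset[of _ "{..t k}"]) (auto simp: C_def)
  have C: "card (C k) \<le> \<rho> k" for k
  proof -
    have "C k \<subseteq> {Suc (t k) - \<rho> k..<Suc (t k)}" by (auto simp: C_def)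
    from card_mono[OF _ this] show ?thesis by auto
  qed
  have clash: False
    if "i < i'" "i \<in> A" "i' \<in> A" "y \<in> B i" "y \<in> B i'" "blocker i = blocker i'" for i i' y
  proof -
    have bads: "i \<in> bad" "i' \<in> bad" using that by (auto simp: A_def)
    have hit: "hits i' (blocker i)" using bads bad_blocker that by auto
    then have "t i + 4 * \<rho> i < t i'"
      using uncovered_late[OF bads(1) refl that(1)] hits_uncovered[OF hit] u_le[of i']
      by (auto simp: hits_def)
    then show False using that by (auto simp: B_def)
  qed
  have "inj_on ?f (Sigma A B)"
  proof (rule inj_onI, clarsimp)
    fix i i' y assume "i \<in> A" "i' \<in> A" "y \<in> B i" "y \<in> B i'" "blocker i = blocker i'"
    then show "i = i'" using clash[of i i' y] clash[of i' i y] by (cases i i' rule: linorder_cases) auto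
  qed
  moreover have "?f ` Sigma A B \<subseteq> Sigma {..<N} C"
    using bad_blocker by (fastforce simp: A_def B_def C_def hits_def)
  ultimately have le: "card (Sigma A B) \<le> card (Sigma {..<N} C)"
    using fC by (intro card_inj_on_le[of ?f]) auto
  have "4 * (\<Sum>i\<in>A. \<rho> i) = (\<Sum>i\<in>A. card (B i))"
    by (simp add: sum_distrib_left B_def)
  also have "\<dots> \<le> (\<Sum>k<N. card (C k))" using le fA fC by (simp add: card_SigmaI B_def)
  also have "\<dots> \<le> (\<Sum>k<N. \<rho> k)" using C by (intro sum_mono)
  finally show ?thesis by (simp add: A_def)
qed

lemma sum_rho_good: "(\<Sum>i<N. \<rho> i) \<le> 2 * (\<Sum>i\<in>{..<N} - bad. \<rho> i)"
proof -
  have fin: "finite bad" using bad_subset finite_subset by blast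
  have eq: "bad = {i. i \<in> bad \<and> t (blocker i) \<le> t i + 4 * \<rho> i} \<union>
      {i. i \<in> bad \<and> t i + 4 * \<rho> i < t (blocker i)}" (is "_ = ?A \<union> ?B")
    by auto
  have "(\<Sum>i\<in>bad. \<rho> i) = (\<Sum>i\<in>?A. \<rho> i) + (\<Sum>i\<in>?B. \<rho> i)"
    using fin by (subst eq, subst sum.union_disjoint) auto
  then have "4 * (\<Sum>i\<in>bad. \<rho> i) \<le> 2 * (\<Sum>i<N. \<rho> i)"
    using sum_rho_quick sum_rho_slow by linarith
  moreover have "(\<Sum>i<N. \<rho> i) = (\<Sum>i\<in>{..<N} - bad. \<rho> i) + (\<Sum>i\<in>bad. \<rho> i)"
    using bad_subset by (intro sum.subset_diff) auto
  ultimately show ?thesis by linarith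
qed

end

section \<open>Lower bounds for feasible solutions\<close>

lemma timeline_rtrancl_le:
  assumes "(p, q) \<in> F\<^sup>*" "F \<subseteq> timeline_edges n"
  shows "fst p \<le> fst q \<and> snd p \<le> snd q"
  using assms(1)
proof induction
  case (step y z)
  then have "(y, z) \<in> timeline_edges n" using assms by auto
  then show ?case using step by (auto simp: timeline_edges_def)
qed simp

text \<open>The level, column plus time, grows by exactly one along each edge, so a path skips no
  level.\<close>

lemma path_meets_level:
  assumes "((0, 0), r) \<in> F\<^sup>*" "F \<subseteq> timeline_edges n" "0 < l" "l \<le> fst r + snd r"
  shows "\<exists>e\<in>F. fst (snd e) + snd (snd e) = l \<and> fst (snd e) \<le> fst r \<and> snd (snd e) \<le> snd r"
  using assms(1,4)
proof (induction rule: rtrancl_induct)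
  case base
  then show ?case using assms(3) by simp
next
  case (step y z)
  have yz: "(y, z) \<in> timeline_edges n" using step assms by auto
  then have lev: "fst z + snd z = Suc (fst y + snd y)" "fst y \<le> fst z" "snd y \<le> snd z"
    by (auto simp: timeline_edges_def)
  show ?case
  proof (cases "l \<le> fst y + snd y")
    case True
    then obtain e where "e \<in> F" "fst (snd e) + snd (snd e) = l" "fst (snd e) \<le> fst y" "snd (snd e) \<le> snd y"
      using step by auto
    then show ?thesis using lev by (intro bexI[of _ e]) auto
  next
    case False
    then show ?thesis using step lev by (intro bexI[of _ "(y, z)"]) auto
  qed
qed

lemma card_ge_levels:
  fixes f :: "'a \<Rightarrow> nat"
  assumes "finite D" "\<And>l. a < l \<Longrightarrow> l \<le> b \<Longrightarrow> \<exists>e\<in>D. f e = l"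
  shows "b - a \<le> card D"
proof -
  have "{a<..b} \<subseteq> f ` D" using assms(2) by fastforce
  then have "card {a<..b} \<le> card (f ` D)" using assms(1) by (intro card_mono) auto
  also have "\<dots> \<le> card D" using assms(1) by (rule card_image_le)
  finally show ?thesis by simp
qed

lemma feasible_card_ge_time:
  assumes "dmcd_feasible n rs F" "r \<in> set rs"
  shows "snd r \<le> card F"
proof -
  have F: "finite F" "F \<subseteq> timeline_edges n" "((0, 0), r) \<in> F\<^sup>*"
    using assms by (auto simp: dmcd_feasible_def)
  have "fst r + snd r - 0 \<le> card F"
    by (rule card_ge_levels[of _ _ _ "\<lambda>e. fst (snd e) + snd (snd e)"])
      (use F(1) path_meets_level[OF F(3,2)] in blast)+
  then show ?thesis by simp
qed

text \<open>An edge head dominated by \<open>(v, t)\<close> and less than \<open>\<rho>\<close>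
  levels below it lies in the square, so each of the last \<open>\<rho>\<close> levels of the path
  contributes an edge.\<close>

lemma feasible_card_ge_square:
  assumes "dmcd_feasible n rs F" "(v, t) \<in> set rs" "\<rho> \<le> v"
  shows "\<rho> \<le> card {e \<in> F. snd e \<in> {(x, y). x \<le> v \<and> v < x + \<rho> \<and> y \<le> t \<and> t < y + \<rho>}}"
    (is "_ \<le> card ?D")
proof -
  have F: "finite F" "F \<subseteq> timeline_edges n" "((0, 0), (v, t)) \<in> F\<^sup>*"
    using assms by (auto simp: dmcd_feasible_def)
  have "(v + t) - (v + t - \<rho>) \<le> card ?D"
  proof (rule card_ge_levels[of _ _ _ "\<lambda>e. fst (snd e) + snd (snd e)"])
    show "finite ?D" using F by simp
    fix l assume l: "v + t - \<rho> < l" "l \<le> v + t"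
    then obtain e where e: "e \<in> F" "fst (snd e) + snd (snd e) = l" "fst (snd e) \<le> v" "snd (snd e) \<le> t"
      using path_meets_level[OF F(3,2), of l] by auto
    then show "\<exists>e\<in>?D. fst (snd e) + snd (snd e) = l"
      using l by (intro bexI[of _ e]) (auto simp: case_prod_unfold)
  qed
  then show ?thesis using assms(3) by simp
qed

context square_run
begin

lemma rho_le_v: "i < N \<Longrightarrow> \<rho> i \<le> v i"
  using rho_le[of i 0 "t i"] by (auto simp: known_def)

text \<open>Squares of good requests are disjoint, so their lower bounds add up, and good requests
  carry at least half of all radii.\<close>

lemma sum_rho_le_feasible:
  assumes F: "dmcd_feasible n rs F" and rs: "\<And>i. i < N \<Longrightarrow> (v i, t i) \<in> set rs"
  shows "(\<Sum>i<N. \<rho> i) \<le> 2 * card F"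
proof -
  let ?E = "\<lambda>i. {e \<in> F. snd e \<in> square i}"
  have fin: "finite F" using F by (simp add: dmcd_feasible_def)
  have "?E i \<inter> ?E j = {}" if "i \<in> {..<N} - bad" "j \<in> {..<N} - bad" "i \<noteq> j" for i j
    using good_squares_disjoint[of i j] good_squares_disjoint[of j i] that
    by (cases i j rule: linorder_cases) auto
  then have "(\<Sum>i\<in>{..<N} - bad. card (?E i)) = card (\<Union>i\<in>{..<N} - bad. ?E i)"
    using fin by (intro card_UN_disjoint[symmetric]) auto
  also have "\<dots> \<le> card F" using fin by (intro card_mono) auto
  finally have "(\<Sum>i\<in>{..<N} - bad. card (?E i)) \<le> card F" .
  moreover have "(\<Sum>i\<in>{..<N} - bad. \<rho> i) \<le> (\<Sum>i\<in>{..<N} - bad. card (?E i))"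
    using feasible_card_ge_square[OF F rs rho_le_v] by (intro sum_mono) (auto simp: square_def)
  ultimately show ?thesis using sum_rho_good by linarith
qed

end

section \<open>Replicas, reachability and size of added segments\<close>

lemma replicas_arcs:
  assumes "(u, s) \<in> replicas F" "s \<le> t"
  shows "replicas (F \<union> arcs u s t) = replicas F \<union> {(u, y) | y. s \<le> y \<and> y \<le> t}"
proof
  show "replicas (F \<union> arcs u s t) \<subseteq> replicas F \<union> {(u, y) | y. s \<le> y \<and> y \<le> t}"
    by (auto simp: replicas_def Field_def arcs_def)
  have "(u, y) \<in> replicas (F \<union> arcs u s t)" if "s \<le> y" "y \<le> t" for y
  proof -
    have "(u, y) \<in> replicas (F \<union> arcs u s y)"
      using arcs_extend_replicas assms(1) that by blast
    moreover have "arcs u s y \<subseteq> arcs u s t" using that by (auto simp: arcs_def)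
    ultimately show ?thesis by (auto simp: replicas_def Field_def)
  qed
  then show "replicas F \<union> {(u, y) | y. s \<le> y \<and> y \<le> t} \<subseteq> replicas (F \<union> arcs u s t)"
    by (auto simp: replicas_def Field_def)
qed

lemma replicas_horizontal:
  assumes "(u, t) \<in> replicas F" "u \<le> v"
  shows "replicas (F \<union> horizontal u v t) = replicas F \<union> {(x, t) | x. u \<le> x \<and> x \<le> v}"
proof
  show "replicas (F \<union> horizontal u v t) \<subseteq> replicas F \<union> {(x, t) | x. u \<le> x \<and> x \<le> v}"
    by (auto simp: replicas_def Field_def horizontal_def)
  have "(x, t) \<in> replicas (F \<union> horizontal u v t)" if "u \<le> x" "x \<le> v" for x
  proof (cases "u = x")
    case True
    then show ?thesis using assms by (auto simp: replicas_def Field_def)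
  next
    case False
    then have "((x - 1, t), (x, t)) \<in> horizontal u v t" using that by (auto simp: horizontal_def)
    then show ?thesis by (auto simp: replicas_def Field_def)
  qed
  then show "replicas F \<union> {(x, t) | x. u \<le> x \<and> x \<le> v} \<subseteq> replicas (F \<union> horizontal u v t)"
    by (auto simp: replicas_def Field_def)
qed

text \<open>The invariant behind feasibility; it survives because each new segment starts at a
  present replica.\<close>

definition origin_connected :: "edge set \<Rightarrow> bool" where
  "origin_connected F \<longleftrightarrow> (\<forall>q \<in> replicas F. ((0, 0), q) \<in> F\<^sup>*)"

lemma origin_connected_arcs:
  assumes F: "origin_connected F" "(u, s) \<in> replicas F" and "s \<le> t"
  shows "origin_connected (F \<union> arcs u s t)"
  unfolding origin_connected_def replicas_arcs[OF F(2) \<open>s \<le> t\<close>]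
proof
  let ?F = "F \<union> arcs u s t"
  have old: "((0, 0), q) \<in> ?F\<^sup>*" if "q \<in> replicas F" for q
    using F(1) that rtrancl_mono[of F ?F] by (auto simp: origin_connected_def)
  fix q assume "q \<in> replicas F \<union> {(u, y) | y. s \<le> y \<and> y \<le> t}"
  then consider "q \<in> replicas F" | y where "q = (u, y)" "s \<le> y" "y \<le> t" by auto
  then show "((0, 0), q) \<in> ?F\<^sup>*"
  proof cases
    case (2 y)
    have "arcs u s y \<subseteq> ?F" using 2 by (auto simp: arcs_def)
    then have "((u, s), q) \<in> ?F\<^sup>*" using arcs_path[of s y u] 2 rtrancl_mono by blast
    then show ?thesis using old[OF F(2)] by simp
  qed (use old in simp)
qed

lemma origin_connected_horizontal:
  assumes F: "origin_connected F" "(u, t) \<in> replicas F" and "u \<le> v"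
  shows "origin_connected (F \<union> horizontal u v t)"
  unfolding origin_connected_def replicas_horizontal[OF F(2) \<open>u \<le> v\<close>]
proof
  let ?F = "F \<union> horizontal u v t"
  have old: "((0, 0), q) \<in> ?F\<^sup>*" if "q \<in> replicas F" for q
    using F(1) that rtrancl_mono[of F ?F] by (auto simp: origin_connected_def)
  fix q assume "q \<in> replicas F \<union> {(x, t) | x. u \<le> x \<and> x \<le> v}"
  then consider "q \<in> replicas F" | x where "q = (x, t)" "u \<le> x" "x \<le> v" by auto
  then show "((0, 0), q) \<in> ?F\<^sup>*"
  proof cases
    case (2 x)
    have "horizontal u x t \<subseteq> ?F" using 2 by (auto simp: horizontal_def)
    then have "((u, t), q) \<in> ?F\<^sup>*" using horizontal_path[of u x t] 2 rtrancl_mono by blast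
    then show ?thesis using old[OF F(2)] by simp
  qed (use old in simp)
qed

lemma card_arcs: "finite (arcs u s t)" "card (arcs u s t) = t - s"
proof -
  have "arcs u s t = (\<lambda>k. ((u, k), (u, Suc k))) ` {s..<t}" by (auto simp: arcs_def)
  then show "finite (arcs u s t)" "card (arcs u s t) = t - s"
    by (simp_all add: card_image inj_on_def)
qed

lemma card_horizontal: "finite (horizontal u v t)" "card (horizontal u v t) = v - u"
proof -
  have "horizontal u v t = (\<lambda>x. ((x, t), (Suc x, t))) ` {u..<v}" by (auto simp: horizontal_def)
  then show "finite (horizontal u v t)" "card (horizontal u v t) = v - u"
    by (simp_all add: card_image inj_on_def)
qed

lemma arcs_subset_timeline: "v \<le> n \<Longrightarrow> arcs v s t \<subseteq> timeline_edges n"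
  by (auto simp: arcs_def timeline_edges_def)

lemma horizontal_subset_timeline: "v \<le> n \<Longrightarrow> horizontal u v t \<subseteq> timeline_edges n"
  by (auto simp: horizontal_def timeline_edges_def)

section \<open>From the algorithm to the abstract run\<close>

lemma square_stepD:
  assumes "square_step t0 F r F'" and P: "P = replicas (F \<union> arcs 0 t0 (snd r))"
  shows "\<exists>u s \<rho>. (u, s) \<in> P \<and> u \<le> fst r \<and> fst r \<le> u + 5 * \<rho> \<and> s \<le> snd r \<and> snd r \<le> s + 5 * \<rho> \<and>
    (\<forall>x y. (x, y) \<in> P \<longrightarrow> x \<le> fst r \<longrightarrow> y \<le> snd r \<longrightarrow> \<rho> \<le> max (snd r - y) (fst r - x)) \<and>
    (\<exists>x y. (x, y) \<in> P \<and> x \<le> fst r \<and> y \<le> snd r \<and> max (snd r - y) (fst r - x) = \<rho>) \<and>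
    (\<forall>x y. (x, y) \<in> P \<longrightarrow> x \<le> fst r \<longrightarrow> fst r \<le> x + 5 * \<rho> \<longrightarrow> y \<le> snd r \<longrightarrow>
      snd r \<le> y + 5 * \<rho> \<longrightarrow> u \<le> x) \<and>
    F' = F \<union> arcs 0 t0 (snd r) \<union> arcs u s (snd r) \<union> horizontal u (fst r) (snd r) \<union>
      arcs u (snd r) (snd r + 4 * \<rho>)"
  using assms(1)
proof cases
  case (1 F1 t \<rho> v u s)
  have PF: "P = replicas F1" using 1 P by simp
  let ?D = "(\<lambda>q. d_infty q (v, t)) ` P"
  have lower: "\<rho> \<le> max (t - y) (v - x)" if "(x, y) \<in> P" "x \<le> v" "y \<le> t" for x y
  proof -
    have "Inf ?D \<le> d_infty (x, y) (v, t)" using that by (intro INF_lower)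
    then have "enat \<rho> \<le> enat (max (t - y) (v - x))"
      using 1(3) PF that by simp
    then show ?thesis by simp
  qed
  \<comment> \<open>The infimum is attained because \<open>enat\<close> is well-ordered and
    \<open>(0, 0)\<close> belongs to every state.\<close>
  have "Inf ?D \<in> ?D"
    by (rule wellorder_InfI[of "d_infty (0, 0) (v, t)"]) (simp add: PF replicas_def)
  then obtain q where q: "q \<in> P" "d_infty q (v, t) = enat \<rho>" using 1(3) PF by auto
  obtain x y where xy: "q = (x, y)" by (cases q)
  have "\<exists>x y. (x, y) \<in> P \<and> x \<le> v \<and> y \<le> t \<and> max (t - y) (v - x) = \<rho>"
    using q xy by (intro exI[of _ x] exI[of _ y]) (auto split: if_splits)
  moreover have "u \<le> x"
    if "(x, y) \<in> P" "x \<le> v" "v \<le> x + 5 * \<rho>" "y \<le> t" "t \<le> y + 5 * \<rho>" for x y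
    using 1(5) that PF by (auto simp: rectangle_def)
  moreover have "(u, s) \<in> P" "u \<le> v" "v \<le> u + 5 * \<rho>" "s \<le> t" "t \<le> s + 5 * \<rho>"
    using 1(4) PF by (auto simp: rectangle_def)
  ultimately show ?thesis
    unfolding 1(1) fst_conv snd_conv
    using 1(6)[unfolded 1(2)] lower
    by - (rule exI[of _ u], rule exI[of _ s], rule exI[of _ \<rho>], simp)
qed

lemma square_from_states:
  assumes "square_from t0 F rs F'"
  shows "\<exists>G. G 0 = F \<and> G (length rs) = F' \<and>
    (\<forall>i < length rs. square_step ((t0 # map snd rs) ! i) (G i) (rs ! i) (G (Suc i)))"
  using assms
proof induction
  case (1 t0 F)
  then show ?case by (intro exI[of _ "\<lambda>_. F"]) simp
next
  case (2 t0 F v t F' rs F'')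
  then obtain G where G: "G 0 = F'" "G (length rs) = F''"
    "\<forall>i < length rs. square_step ((t # map snd rs) ! i) (G i) (rs ! i) (G (Suc i))" by blast
  show ?case
    using G 2(1) by (intro exI[of _ "case_nat F G"]) (auto simp: less_Suc_eq_0_disj)
qed

lemma square_output_run:
  assumes rs: "request_sequence n rs" and out: "square_output rs F"
  obtains u s \<rho> where
    "square_run (\<lambda>i. fst (rs ! i)) (\<lambda>i. snd (rs ! i)) u s \<rho> (length rs)"
    "finite F" "F \<subseteq> timeline_edges n" "origin_connected F" "set rs \<subseteq> replicas F"
    "card F \<le> last (0 # map snd rs) + 14 * (\<Sum>i<length rs. \<rho> i)"
proof -
  define N where "N = length rs"
  define v where "v i = fst (rs ! i)" for i
  define t where "t i = snd (rs ! i)" for i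
  \<comment> \<open>The time of the preceding request, with 0 as the initial time.\<close>
  define t' where "t' i = (0 # map snd rs) ! i" for i
  have t'0: "t' 0 = 0" by (simp add: t'_def)
  have t'Suc: "t' (Suc i) = t i" if "i < N" for i
    using that by (simp add: t'_def t_def N_def)
  have srt: "sorted (0 # map snd rs)" using rs by (simp add: request_sequence_def)
  have t'_le: "t' i \<le> t i" if "i < N" for i
    using sorted_nth_mono[OF srt, of i "Suc i"] that t'Suc[OF that] by (simp add: t'_def N_def)
  have t_mono: "t i \<le> t j" if "i \<le> j" "j < N" for i j
    using sorted_nth_mono[of "map snd rs" i j] srt that by (simp add: t_def N_def)
  have v_n: "v i \<le> n" if "i < N" for i
    using rs nth_mem[of i rs] that by (auto simp: request_sequence_def v_def N_def case_prod_unfold)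
  obtain G where G: "G 0 = {}" "G N = F"
    "\<And>i. i < N \<Longrightarrow> square_step (t' i) (G i) (rs ! i) (G (Suc i))"
    using square_from_states[OF out[unfolded square_output_def]] by (auto simp: t'_def N_def)
  define P where "P i = replicas (G i \<union> arcs 0 (t' i) (t i))" for i
  let ?S = "\<lambda>i u s \<rho>. (u, s) \<in> P i \<and> u \<le> v i \<and> v i \<le> u + 5 * \<rho> \<and> s \<le> t i \<and> t i \<le> s + 5 * \<rho> \<and>
    (\<forall>x y. (x, y) \<in> P i \<longrightarrow> x \<le> v i \<longrightarrow> y \<le> t i \<longrightarrow> \<rho> \<le> max (t i - y) (v i - x)) \<and>
    (\<exists>x y. (x, y) \<in> P i \<and> x \<le> v i \<and> y \<le> t i \<and> max (t i - y) (v i - x) = \<rho>) \<and>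
    (\<forall>x y. (x, y) \<in> P i \<longrightarrow> x \<le> v i \<longrightarrow> v i \<le> x + 5 * \<rho> \<longrightarrow> y \<le> t i \<longrightarrow>
      t i \<le> y + 5 * \<rho> \<longrightarrow> u \<le> x) \<and>
    G (Suc i) = G i \<union> arcs 0 (t' i) (t i) \<union> arcs u s (t i) \<union> horizontal u (v i) (t i) \<union>
      arcs u (t i) (t i + 4 * \<rho>)"
  have "\<forall>i. \<exists>u s \<rho>. i < N \<longrightarrow> ?S i u s \<rho>"
    using square_stepD[OF G(3) refl] by (simp add: P_def v_def t_def)
  then obtain u s \<rho> where S: "\<And>i. i < N \<Longrightarrow> ?S i (u i) (s i) (\<rho> i)"
    unfolding choice_iff by blast
  interpret square_data v t u s \<rho> .
  \<comment> \<open>The state before (SQ1) of round \<open>i\<close>, so the origin column ends at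
    \<open>t' i\<close>, not yet at \<open>t i\<close>.\<close>
  let ?known = "\<lambda>i. {(0, y) | y. y \<le> t' i} \<union> (\<Union>k<i. served k)"
  have inv: "replicas (G i) = ?known i \<and> origin_connected (G i) \<and> finite (G i) \<and>
      G i \<subseteq> timeline_edges n \<and> card (G i) \<le> t' i + 14 * (\<Sum>k<i. \<rho> k) \<and>
      (\<forall>k<i. P k = known k)" if "i \<le> N" for i
    using that
  proof (induction i)
    case 0
    then show ?case
      using G(1) by (auto simp: replicas_def origin_connected_def t'0)
  next
    case (Suc i)
    then have iN: "i < N" by simp
    note IH = Suc.IH[OF less_imp_le[OF iN]]
    note Si = S[OF iN]
    define A where "A = G i \<union> arcs 0 (t' i) (t i)"
    define B where "B = A \<union> arcs (u i) (s i) (t i)"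
    define C where "C = B \<union> horizontal (u i) (v i) (t i)"
    have Gi: "G (Suc i) = C \<union> arcs (u i) (t i) (t i + 4 * \<rho> i)"
      using Si by (simp add: A_def B_def C_def)
    have u: "u i \<le> v i" "v i \<le> u i + 5 * \<rho> i" and s: "s i \<le> t i" "t i \<le> s i + 5 * \<rho> i"
      and us: "(u i, s i) \<in> replicas A"
      using Si by (auto simp: P_def A_def)
    have zero: "(0, t' i) \<in> replicas (G i)" using IH by auto
    have A: "replicas A = known i" "origin_connected A"
      using replicas_arcs[OF zero t'_le[OF iN]] origin_connected_arcs[OF _ zero t'_le[OF iN]] IH t'_le[OF iN]
      by (auto simp: A_def known_def)
    have B: "replicas B = replicas A \<union> {(u i, y) | y. s i \<le> y \<and> y \<le> t i}" "origin_connected B"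
      unfolding B_def using replicas_arcs[OF us s(1)] origin_connected_arcs[OF A(2) us s(1)] by auto
    have ut: "(u i, t i) \<in> replicas B" using B s by auto
    have C: "replicas C = replicas B \<union> {(x, t i) | x. u i \<le> x \<and> x \<le> v i}" "origin_connected C"
      unfolding C_def
      using replicas_horizontal[OF ut u(1)] origin_connected_horizontal[OF B(2) ut u(1)] by auto
    have ut': "(u i, t i) \<in> replicas C" using C ut by auto
    have "replicas (G (Suc i)) = replicas C \<union> {(u i, y) | y. t i \<le> y \<and> y \<le> t i + 4 * \<rho> i}"
      unfolding Gi using replicas_arcs[OF ut'] by auto
    also have "\<dots> = known i \<union> served i"
      unfolding C(1) B(1) A(1) served_def using s by auto
    also have "\<dots> = ?known (Suc i)"
      using t'Suc[OF iN] by (auto simp: known_def less_Suc_eq)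
    finally have "replicas (G (Suc i)) = ?known (Suc i)" .
    moreover have "origin_connected (G (Suc i))"
      unfolding Gi using origin_connected_arcs[OF C(2) ut'] by auto
    moreover have "finite (G (Suc i))"
      using IH Gi by (simp add: A_def B_def C_def card_arcs card_horizontal)
    moreover have "G (Suc i) \<subseteq> timeline_edges n"
      unfolding Gi C_def B_def A_def
      using IH arcs_subset_timeline[of _ n] horizontal_subset_timeline[of _ n] u v_n[OF iN] by simp
    \<comment> \<open>14 = 5 + 5 + 4: arcs and horizontal edges of (SQ4), then arcs of (SQ5). The
      cost of (SQ1) telescopes.\<close>
    moreover have "card (G (Suc i)) \<le> t' (Suc i) + 14 * (\<Sum>k<Suc i. \<rho> k)"
    proof -
      have "card (G (Suc i)) \<le> card C + 4 * \<rho> i"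
        unfolding Gi using card_Un_le[of C "arcs (u i) (t i) (t i + 4 * \<rho> i)"] by (simp add: card_arcs)
      moreover have "card C \<le> card B + 5 * \<rho> i"
        unfolding C_def using card_Un_le[of B "horizontal (u i) (v i) (t i)"] u by (simp add: card_horizontal)
      moreover have "card B \<le> card A + 5 * \<rho> i"
        unfolding B_def using card_Un_le[of A "arcs (u i) (s i) (t i)"] s by (simp add: card_arcs)
      moreover have "card A + t' i \<le> card (G i) + t i"
        unfolding A_def using card_Un_le[of "G i" "arcs 0 (t' i) (t i)"] t'_le[OF iN] by (simp add: card_arcs)
      moreover have "card (G i) \<le> t' i + 14 * (\<Sum>k<i. \<rho> k)" using IH by blast
      ultimately have "card (G (Suc i)) \<le> t i + 14 * ((\<Sum>k<i. \<rho> k) + \<rho> i)" by simp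
      then show ?thesis using t'Suc[OF iN] by simp
    qed
    moreover have "\<forall>k<Suc i. P k = known k"
      using IH A(1) by (auto simp: less_Suc_eq P_def A_def)
    ultimately show ?case by blast
  qed
  have PK: "P i = known i" if "i < N" for i using inv[of N] that by simp
  have run: "square_run v t u s \<rho> N"
  proof
    show "t i \<le> t j" if "i \<le> j" "j < N" for i j using t_mono that .
    fix i assume i: "i < N"
    note Si = S[OF i, unfolded PK[OF i]]
    show "(u i, s i) \<in> known i" "u i \<le> v i" "v i \<le> u i + 5 * \<rho> i" "s i \<le> t i" "t i \<le> s i + 5 * \<rho> i"
      "\<exists>x y. (x, y) \<in> known i \<and> x \<le> v i \<and> y \<le> t i \<and> max (t i - y) (v i - x) = \<rho> i"
      using Si by simp_all
    show "\<rho> i \<le> max (t i - y) (v i - x)" if "(x, y) \<in> known i" "x \<le> v i" "y \<le> t i" for x y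
      using Si that by blast
    show "u i \<le> x" if "(x, y) \<in> known i" "x \<le> v i" "v i \<le> x + 5 * \<rho> i"
      "y \<le> t i" "t i \<le> y + 5 * \<rho> i" for x y
      using Si that by blast
  qed
  have "r \<in> replicas F" if "r \<in> set rs" for r
  proof -
    obtain i where i: "i < N" "r = rs ! i" using \<open>r \<in> set rs\<close> by (auto simp: in_set_conv_nth N_def)
    then have "r \<in> served i" using S[OF i(1)] by (auto simp: served_def v_def t_def prod_eq_iff)
    then show ?thesis using inv[of N] G(2) i by auto
  qed
  moreover have "last (0 # map snd rs) = t' N" by (simp add: t'_def N_def last_conv_nth)
  ultimately show thesis
    using that[of u s \<rho>] run inv[of N] G(2) unfolding v_def t_def N_def by (simp add: subset_iff)
qed

theorem theorem1:
  "\<exists>c :: real. \<forall>(n :: nat) (rs :: replica list) (F :: edge set).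
     request_sequence n rs \<longrightarrow> square_output rs F \<longrightarrow>
       dmcd_feasible n rs F \<and> real (card F) \<le> c * real (dmcd_opt n rs)"
\<comment> \<open>29 = 1 + 14 * 2: the origin column costs at most the optimum, the radii sum to at
  most twice the optimum.\<close>
proof (intro exI[of _ "29 :: real"] allI impI)
  fix n rs F
  assume rs: "request_sequence n rs" and out: "square_output rs F"
  from square_output_run[OF this] obtain u s \<rho> where
    run: "square_run (\<lambda>i. fst (rs ! i)) (\<lambda>i. snd (rs ! i)) u s \<rho> (length rs)"
    and F: "finite F" "F \<subseteq> timeline_edges n" "origin_connected F" "set rs \<subseteq> replicas F"
    and card: "card F \<le> last (0 # map snd rs) + 14 * (\<Sum>i<length rs. \<rho> i)" by blast
  interpret square_run "\<lambda>i. fst (rs ! i)" "\<lambda>i. snd (rs ! i)" u s \<rho> "length rs" by (fact run)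
  have "\<exists>k E. dmcd_feasible n rs E \<and> card E = k" using dmcd_feasible_exists[OF rs] by blast
  from LeastI_ex[OF this] obtain E where E: "dmcd_feasible n rs E" "card E = dmcd_opt n rs"
    unfolding dmcd_opt_def by blast
  have "(\<Sum>i<length rs. \<rho> i) \<le> 2 * card E"
    using sum_rho_le_feasible[OF E(1)] by simp
  moreover have "last (0 # map snd rs) \<le> card E"
    using feasible_card_ge_time[OF E(1)] by (cases rs rule: rev_cases) auto
  ultimately have "card F \<le> 29 * dmcd_opt n rs" using card E(2) by simp
  then have "real (card F) \<le> real (29 * dmcd_opt n rs)" by (simp only: of_nat_le_iff)
  moreover have "dmcd_feasible n rs F"
    using F by (auto simp: dmcd_feasible_def origin_connected_def)
  ultimately show "dmcd_feasible n rs F \<and> real (card F) \<le> 29 * real (dmcd_opt n rs)" by simp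
qed

end
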